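(* Let $(V,K,\tilde\rho,\tilde\mu)$ be a representation of a regular pre-LieDer pair $(\mathfrak g,D)$. Then $(\bigoplus_{n=0}^{+\infty}C^n(\mathfrak g,D;V,K,\tilde\rho,\tilde\mu),\mathcal D_{(\tilde\rho,\tilde\mu)})$, with cochains and operator as defined in the context, is a cochain complex, i.e. $\mathcal D_{(\tilde\rho,\tilde\mu)}\circ\mathcal D_{(\tilde\rho,\tilde\mu)}=0$.
   Context: All vector spaces are over an algebraically closed field $\mathbb K$ of characteristic $0$. Pre-Lie algebra: a vector space $\mathfrak g$ with a bilinear product $\cdot$ such that $(x\cdot y)\cdot z-x\cdot(y\cdot z)=(y\cdot x)\cdot z-y\cdot(x\cdot z)$; $[x,y]_C=x\cdot y-y\cdot x$ is the bracket of the sub-adjacent Lie algebra $\mathfrak g^C$. A representation $(V;\tilde\rho,\tilde\mu)$ of it consists of a representation $\tilde\rho:\mathfrak g\to\mathfrak{gl}(V)$ of $\mathfrak g^C$ and a linear map $\tilde\mu:\mathfrak g\to\mathfrak{gl}(V)$ with $\tilde\mu(y)\tilde\mu(x)-\tilde\mu(x\cdot y)=\tilde\mu(y)\tilde\rho(x)-\tilde\rho(x)\tilde\mu(y)$. A regular pre-LieDer pair $(\mathfrak g,D)$ is a pre-Lie algebra with a linear map $D:\mathfrak g\to\mathfrak g$ satisfying $D(x\cdot y)=x\cdot D(y)+D(x)\cdot y$. A representation $(V,K,\tilde\rho,\tilde\mu)$ of $(\mathfrak g,D)$ is a representation $(V;\tilde\rho,\tilde\mu)$ of the pre-Lie algebra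 $(\mathfrak g,\cdot)$ with a linear map $K:V\to V$ such that $K(\tilde\rho(x)u)=\tilde\rho(x)K(u)+\tilde\rho(D(x))u$ and $K(\tilde\mu(x)u)=\tilde\mu(x)K(u)+\tilde\mu(D(x))u$ for all $x\in\mathfrak g,u\in V$. Cochains $C^n:=C^n(\mathfrak g,D;V,K,\tilde\rho,\tilde\mu)$: $C^0=0$, $C^1=\mathrm{Hom}(\mathfrak g,V)$ and for $n\ge2$, $C^n=\mathrm{Hom}(\wedge^{n-1}\mathfrak g\otimes\mathfrak g,V)\oplus\mathrm{Hom}(\wedge^{n-2}\mathfrak g\otimes\mathfrak g,V)$. For $n\ge1$ and $f\in\mathrm{Hom}(\wedge^{n-1}\mathfrak g\otimes\mathfrak g,V)$, $$(\mathrm d_{(\tilde\rho,\tilde\mu)}f)(x_1,\dots,x_{n+1})=\sum_{i=1}^n(-1)^{i+1}\tilde\rho(x_i)f(x_1,\dots,\hat{x_i},\dots,x_{n+1})+\sum_{i=1}^n(-1)^{i+1}\tilde\mu(x_{n+1})f(x_1,\dots,\hat{x_i},\dots,x_n,x_i)$$ $$-\sum_{i=1}^n(-1)^{i+1}f(x_1,\dots,\hat{x_i},\dots,x_n,x_i\cdot x_{n+1})+\sum_{1\le i<j\le n}(-1)^{i+j}f([x_i,x_j]_C,x_1,\dots,\hat{x_i},\dots,\hat{x_j},\dots,x_{n+1}),$$ $$(\Omega_{(\tilde\rho,\tilde\mu)}f)(x_1,\dots,x_n)=(-1)^{n-2}\Big(\sum_{i=1}^nf(x_1,\dots,x_{i-1},D(x_i),x_{i+1},\dots,x_n)-K(f(x_1,\dots,x_n))\Big).$$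 The operator $\mathcal D_{(\tilde\rho,\tilde\mu)}:C^n\to C^{n+1}$ is $\mathcal D_{(\tilde\rho,\tilde\mu)}(f,\theta)=(\mathrm d_{(\tilde\rho,\tilde\mu)}f,\mathrm d_{(\tilde\rho,\tilde\mu)}\theta+\Omega_{(\tilde\rho,\tilde\mu)}f)$ ($\theta=0$ for $n=1$). *)

theory Defs
  imports
    "HOL-Computational_Algebra.Polynomial"
    "HOL-Library.Function_Algebras"
    "HOL-Library.Product_Plus"
begin

section \<open>Pre-Lie algebras, regular pre-LieDer pairs and their representations\<close>

locale pre_lie_algebra = vector_space scale
  for scale :: "'k::{alg_closed_field, field_char_0} \<Rightarrow> 'g::ab_group_add \<Rightarrow> 'g" +
  fixes mul :: "'g \<Rightarrow> 'g \<Rightarrow> 'g"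
  assumes linear_mul_left: "Vector_Spaces.linear scale scale (\<lambda>x. mul x y)"
    and linear_mul_right: "Vector_Spaces.linear scale scale (\<lambda>y. mul x y)"
    and pre_lie_identity:
      "mul (mul x y) z - mul x (mul y z) = mul (mul y x) z - mul y (mul x z)"

definition commutator :: "('g::ab_group_add \<Rightarrow> 'g \<Rightarrow> 'g) \<Rightarrow> 'g \<Rightarrow> 'g \<Rightarrow> 'g"
  where "commutator mul x y = mul x y - mul y x"

locale pre_lie_rep = pre_lie_algebra sg mul + V: vector_space sv
  for sg :: "'k::{alg_closed_field, field_char_0} \<Rightarrow> 'g::ab_group_add \<Rightarrow> 'g"
    and mul :: "'g \<Rightarrow> 'g \<Rightarrow> 'g"
    and sv :: "'k \<Rightarrow> 'v::ab_group_add \<Rightarrow> 'v" +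
  fixes \<rho> \<mu> :: "'g \<Rightarrow> 'v \<Rightarrow> 'v"
  assumes linear_rho: "Vector_Spaces.linear sv sv (\<rho> x)"
    and linear_rho_arg: "Vector_Spaces.linear sg sv (\<lambda>x. \<rho> x u)"
    and rho_commutator: "\<rho> (commutator mul x y) u = \<rho> x (\<rho> y u) - \<rho> y (\<rho> x u)"
    and linear_mu: "Vector_Spaces.linear sv sv (\<mu> x)"
    and linear_mu_arg: "Vector_Spaces.linear sg sv (\<lambda>x. \<mu> x u)"
    and mu_mul: "\<mu> y (\<mu> x u) - \<mu> (mul x y) u = \<mu> y (\<rho> x u) - \<rho> x (\<mu> y u)"

locale regular_pre_LieDer_pair = pre_lie_algebra sg mul
  for sg :: "'k::{alg_closed_field, field_char_0} \<Rightarrow> 'g::ab_group_add \<Rightarrow> 'g"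
    and mul :: "'g \<Rightarrow> 'g \<Rightarrow> 'g" +
  fixes D :: "'g \<Rightarrow> 'g"
  assumes linear_D: "Vector_Spaces.linear sg sg D"
    and D_mul: "D (mul x y) = mul x (D y) + mul (D x) y"

locale regular_pre_LieDer_rep =
  regular_pre_LieDer_pair sg mul D + pre_lie_rep sg mul sv \<rho> \<mu>
  for sg :: "'k::{alg_closed_field, field_char_0} \<Rightarrow> 'g::ab_group_add \<Rightarrow> 'g"
    and mul :: "'g \<Rightarrow> 'g \<Rightarrow> 'g"
    and D :: "'g \<Rightarrow> 'g"
    and sv :: "'k \<Rightarrow> 'v::ab_group_add \<Rightarrow> 'v"
    and K :: "'v \<Rightarrow> 'v"
    and \<rho> \<mu> :: "'g \<Rightarrow> 'v \<Rightarrow> 'v" +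
  assumes linear_K: "Vector_Spaces.linear sv sv K"
    and K_rho: "K (\<rho> x u) = \<rho> x (K u) + \<rho> (D x) u"
    and K_mu: "K (\<mu> x u) = \<mu> x (K u) + \<mu> (D x) u"


section \<open>Cochains\<close>

text \<open>
  \<open>wedge_hom sg sv p\<close> is \<open>Hom(\<Wedge>\<^sup>p g \<otimes> g, V)\<close>: the maps of \<open>p + 1\<close> arguments that are linear in
  each argument and alternating in the first \<open>p\<close> of them. Arguments are passed as a list
  (indexed from 0); the value is fixed to 0 on lists of any other length, so that equality of
  cochains is equality of functions.
\<close>

definition wedge_hom ::
  "('k::field \<Rightarrow> 'g::ab_group_add \<Rightarrow> 'g) \<Rightarrow> ('k \<Rightarrow> 'v::ab_group_add \<Rightarrow> 'v) \<Rightarrow> nat \<Rightarrow> ('g list \<Rightarrow> 'v) set"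
  where "wedge_hom sg sv p =
    {f. (\<forall>xs. length xs \<noteq> Suc p \<longrightarrow> f xs = 0) \<and>
        (\<forall>xs i. length xs = Suc p \<longrightarrow> i < Suc p \<longrightarrow>
          Vector_Spaces.linear sg sv (\<lambda>x. f (xs[i := x]))) \<and>
        (\<forall>xs i j. length xs = Suc p \<longrightarrow> i < j \<longrightarrow> j < p \<longrightarrow> xs ! i = xs ! j \<longrightarrow> f xs = 0)}"

text \<open>
  All \<open>C\<^sup>n\<close> live in one ambient type of pairs; for \<open>n = 1\<close> the second component is 0.
\<close>

fun cochains ::
  "('k::field \<Rightarrow> 'g::ab_group_add \<Rightarrow> 'g) \<Rightarrow> ('k \<Rightarrow> 'v::ab_group_add \<Rightarrow> 'v) \<Rightarrow>
    nat \<Rightarrow> (('g list \<Rightarrow> 'v) \<times> ('g list \<Rightarrow> 'v)) set"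
  where
    "cochains sg sv 0 = {0}"
  | "cochains sg sv (Suc 0) = wedge_hom sg sv 0 \<times> {0}"
  | "cochains sg sv (Suc (Suc m)) = wedge_hom sg sv (Suc m) \<times> wedge_hom sg sv m"

definition cochain_scale ::
  "('k \<Rightarrow> 'v \<Rightarrow> 'v) \<Rightarrow> 'k \<Rightarrow> ('g list \<Rightarrow> 'v) \<times> ('g list \<Rightarrow> 'v) \<Rightarrow> ('g list \<Rightarrow> 'v) \<times> ('g list \<Rightarrow> 'v)"
  where "cochain_scale sv a c = (\<lambda>xs. sv a (fst c xs), \<lambda>xs. sv a (snd c xs))"


section \<open>The coboundary operator\<close>

text \<open>
  In the two operators below \<open>n\<close> is the number of arguments of \<open>f\<close>, and the mathematical
  \<open>x\<^sub>i\<close> is \<open>xs ! (i - 1)\<close>. Shifting the indices turns the sign \<open>(-1)\<^sup>i\<^sup>+\<^sup>1\<close> into \<open>(-1)\<^sup>i\<close>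
  and leaves \<open>(-1)\<^sup>i\<^sup>+\<^sup>j\<close> unchanged. Omitting entries is \<open>nths xs (- A)\<close>, which keeps the
  entries of \<open>xs\<close> at positions outside \<open>A\<close>, in order.
\<close>

definition pre_lie_d ::
  "('k::field \<Rightarrow> 'v::ab_group_add \<Rightarrow> 'v) \<Rightarrow> ('g::ab_group_add \<Rightarrow> 'g \<Rightarrow> 'g) \<Rightarrow>
    ('g \<Rightarrow> 'v \<Rightarrow> 'v) \<Rightarrow> ('g \<Rightarrow> 'v \<Rightarrow> 'v) \<Rightarrow> nat \<Rightarrow> ('g list \<Rightarrow> 'v) \<Rightarrow> 'g list \<Rightarrow> 'v"
  where "pre_lie_d sv mul \<rho> \<mu> n f xs =
    (if length xs = Suc n then
        (\<Sum>i<n. sv ((-1) ^ i) (\<rho> (xs ! i) (f (nths xs (- {i})))))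
      + (\<Sum>i<n. sv ((-1) ^ i) (\<mu> (xs ! n) (f (nths xs (- {i, n}) @ [xs ! i]))))
      - (\<Sum>i<n. sv ((-1) ^ i) (f (nths xs (- {i, n}) @ [mul (xs ! i) (xs ! n)])))
      + (\<Sum>j<n. \<Sum>i<j. sv ((-1) ^ (i + j))
          (f (commutator mul (xs ! i) (xs ! j) # nths xs (- {i, j}))))
     else 0)"

text \<open>
  The exponent \<open>n - 2\<close> is taken in the integers, since \<open>n = 1\<close> occurs.
\<close>

definition Omega ::
  "('k::field \<Rightarrow> 'v::ab_group_add \<Rightarrow> 'v) \<Rightarrow> ('g \<Rightarrow> 'g) \<Rightarrow> ('v \<Rightarrow> 'v) \<Rightarrow>
    nat \<Rightarrow> ('g list \<Rightarrow> 'v) \<Rightarrow> 'g list \<Rightarrow> 'v"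
  where "Omega sv D K n f xs =
    (if length xs = n then
       sv ((-1) powi (int n - 2)) ((\<Sum>i<n. f (xs[i := D (xs ! i)])) - K (f xs))
     else 0)"

fun pre_LieDer_d ::
  "('k::field \<Rightarrow> 'v::ab_group_add \<Rightarrow> 'v) \<Rightarrow> ('g::ab_group_add \<Rightarrow> 'g \<Rightarrow> 'g) \<Rightarrow> ('g \<Rightarrow> 'g) \<Rightarrow>
    ('v \<Rightarrow> 'v) \<Rightarrow> ('g \<Rightarrow> 'v \<Rightarrow> 'v) \<Rightarrow> ('g \<Rightarrow> 'v \<Rightarrow> 'v) \<Rightarrow> nat \<Rightarrow>
    ('g list \<Rightarrow> 'v) \<times> ('g list \<Rightarrow> 'v) \<Rightarrow> ('g list \<Rightarrow> 'v) \<times> ('g list \<Rightarrow> 'v)"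
  where
    "pre_LieDer_d sv mul D K \<rho> \<mu> 0 c = 0"
  | "pre_LieDer_d sv mul D K \<rho> \<mu> (Suc m) (f, \<theta>) =
      (pre_lie_d sv mul \<rho> \<mu> (Suc m) f,
       pre_lie_d sv mul \<rho> \<mu> m \<theta> + Omega sv D K (Suc m) f)"


section \<open>Cochain complexes\<close>

definition cochain_complex ::
  "('k::field \<Rightarrow> 'c::ab_group_add \<Rightarrow> 'c) \<Rightarrow> (nat \<Rightarrow> 'c set) \<Rightarrow> (nat \<Rightarrow> 'c \<Rightarrow> 'c) \<Rightarrow> bool"
  where "cochain_complex s C d \<longleftrightarrow>
    vector_space s \<and>
    (\<forall>n. module.subspace s (C n)) \<and>
    (\<forall>n. \<forall>c\<in>C n. d n c \<in> C (Suc n)) \<and>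
    (\<forall>n. \<forall>b\<in>C n. \<forall>c\<in>C n. d n (b + c) = d n b + d n c) \<and>
    (\<forall>n a. \<forall>c\<in>C n. d n (s a c) = s a (d n c)) \<and>
    (\<forall>n. \<forall>c\<in>C n. d (Suc n) (d n c) = 0)"

end

theory Submission
  imports Defs
begin

text \<open>
  Currying the last argument turns \<open>Hom(\<Wedge>\<^sup>p g \<otimes> g, V)\<close> into alternating maps with values in
  \<open>Hom(g, V)\<close>, which is a module over the sub-adjacent Lie algebra under
  \<open>(x \<cdot> \<phi>)(y) = \<rho>(x)\<phi>(y) + \<mu>(y)\<phi>(x) - \<phi>(x \<cdot> y)\<close>; the pre-Lie coboundary becomes the
  Chevalley--Eilenberg differential \<open>d\<close> of this module. By Cartan's formula \<open>d\<close> satisfies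
  \<open>\<iota>\<^sub>x d = L\<^sub>x - d \<iota>\<^sub>x\<close>, which determines it recursively. It follows by induction on the number
  of arguments that \<open>d\<close> commutes with \<open>f \<mapsto> \<delta> \<circ> f - T\<cdot>f\<close> for every derivation \<open>(T, \<delta>)\<close> of the
  Lie algebra and its module. For inner derivations this gives \<open>d L\<^sub>x = L\<^sub>x d\<close>, hence
  \<open>\<iota>\<^sub>x d d = d d \<iota>\<^sub>x\<close> and \<open>d d = 0\<close>; for the derivation induced by \<open>D\<close> and \<open>K\<close> it gives
  \<open>d \<Omega> = - \<Omega> d\<close>, where the sign comes from the factor \<open>(-1)\<^sup>n\<^sup>-\<^sup>2\<close> in \<open>\<Omega>\<close>.
\<close>

section \<open>Derivations acting on functions of lists\<close>

lemma nths_Cons_omit: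
  "nths (x # xs) (- {0}) = xs"
  "nths (x # xs) (- {Suc i}) = x # nths xs (- {i})"
  "nths (x # xs) (- {0, Suc i}) = nths xs (- {i})"
  "nths (x # xs) (- {Suc i, Suc j}) = x # nths xs (- {i, j})"
proof -
  have *: "{j. Suc j \<in> - {0}} = UNIV" "{j. Suc j \<in> - {Suc i}} = - {i}"
    "{j. Suc j \<in> - {0, Suc i}} = - {i}" "{k. Suc k \<in> - {Suc i, Suc j}} = - {i, j}"
    by auto
  show "nths (x # xs) (- {0}) = xs"
    "nths (x # xs) (- {Suc i}) = x # nths xs (- {i})"
    "nths (x # xs) (- {0, Suc i}) = nths xs (- {i})"
    "nths (x # xs) (- {Suc i, Suc j}) = x # nths xs (- {i, j})"
    unfolding nths_Cons * by (simp_all add: nths_all)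
qed

text \<open>This is the natural action of an endomorphism on multilinear maps: one summand for each
  slot to which \<open>T\<close> is applied. The recursive form peels off the head, as Cartan's
  formula does.\<close>

fun der :: "('g \<Rightarrow> 'g) \<Rightarrow> ('g list \<Rightarrow> 'w::ab_group_add) \<Rightarrow> 'g list \<Rightarrow> 'w"
  where
    "der T f [] = 0"
  | "der T f (y # ys) = f (T y # ys) + der T (\<lambda>zs. f (y # zs)) ys"

lemma der_eq_sum: "der T f ys = (\<Sum>i<length ys. f (ys[i := T (ys ! i)]))"
  by (induction ys arbitrary: f) (auto simp: sum.lessThan_Suc_shift simp del: sum.lessThan_Suc)

lemma der_snoc: "der T f (ys @ [y]) = der T (\<lambda>zs. f (zs @ [y])) ys + f (ys @ [T y])"
  by (induction ys arbitrary: f) (simp_all add: add.assoc)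

lemma der_hom:
  assumes "\<And>u v. h (u + v) = h u + h v"
  shows "der T (\<lambda>zs. h (f zs)) ys = h (der T f ys)"
proof -
  interpret additive h by standard (rule assms)
  show ?thesis by (induction ys arbitrary: f) (simp_all add: zero add)
qed

lemma der_add: "der T (\<lambda>zs. f zs + g zs) ys = der T f ys + der T g ys"
  by (simp add: der_eq_sum sum.distrib)

lemma der_diff: "der T (\<lambda>zs. f zs - g zs) ys = der T f ys - der T g ys"
  by (simp add: der_eq_sum sum_subtractf)

text \<open>Contributions where \<open>T\<close> and \<open>U\<close> hit different slots cancel,
  and a slot hit by both carries the commutator. The order is reversed because the outer operator
  reaches the arguments first, so \<open>der T (der U f)\<close> contains
  \<open>U (T y)\<close>.\<close>

lemma der_commute:
  fixes f :: "'g::ab_group_add list \<Rightarrow> 'w::ab_group_add"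
  assumes add: "\<And>as bs x y. f (as @ (x + y) # bs) = f (as @ x # bs) + f (as @ y # bs)"
  shows "der T (der U f) ys - der U (der T f) ys = der (\<lambda>y. U (T y) - T (U y)) f ys"
  using add
proof (induction ys arbitrary: f)
  case (Cons y ys)
  have sub: "f ((x - z) # ys) = f (x # ys) - f (z # ys)" for x z
    using Cons.prems[of "[]" "x - z" z ys] by simp
  have "der T (der U (\<lambda>zs. f (y # zs))) ys - der U (der T (\<lambda>zs. f (y # zs))) ys
      = der (\<lambda>y. U (T y) - T (U y)) (\<lambda>zs. f (y # zs)) ys"
  proof (rule Cons.IH)
    show "f (y # as @ (u + v) # bs) = f (y # as @ u # bs) + f (y # as @ v # bs)" for as bs u v
      using Cons.prems[of "y # as"] by simp
  qed
  \<comment> \<open>The two mixed terms, with one operator on the head and the other on the tail,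
    are exchanged when \<open>P\<close> and \<open>Q\<close> are swapped, so they drop out of the
    difference.\<close>
  moreover have "der P (der Q f) (y # ys) = f (Q (P y) # ys) + der Q (\<lambda>zs. f (P y # zs)) ys
      + (der P (\<lambda>zs. f (Q y # zs)) ys + der P (der Q (\<lambda>zs. f (y # zs))) ys)" for P Q
    by (simp add: der_add)
  ultimately show ?case
    by (simp add: sub)
qed simp

section \<open>Multilinear and alternating functions of lists\<close>

definition alternating :: "('g list \<Rightarrow> 'w::ab_group_add) \<Rightarrow> bool"
  where "alternating f \<longleftrightarrow> (\<forall>as x bs. f (as @ x # x # bs) = 0)"

lemma alternating_Cons: "alternating f \<Longrightarrow> alternating (\<lambda>zs. f (x # zs))"
  by (simp add: alternating_def flip: append_Cons)

locale list_cochains = vector_space_pair s1 s2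
  for s1 :: "'k::field \<Rightarrow> 'g::ab_group_add \<Rightarrow> 'g" and s2 :: "'k \<Rightarrow> 'w::ab_group_add \<Rightarrow> 'w"
begin

definition multilinear :: "('g list \<Rightarrow> 'w) \<Rightarrow> bool"
  where "multilinear f \<longleftrightarrow> (\<forall>as bs. Vector_Spaces.linear s1 s2 (\<lambda>x. f (as @ x # bs)))"

lemma multilinear_Cons: "multilinear f \<Longrightarrow> multilinear (\<lambda>zs. f (x # zs))"
  by (simp add: multilinear_def flip: append_Cons)

lemma multilinear_slot: "multilinear f \<Longrightarrow> Vector_Spaces.linear s1 s2 (\<lambda>x. f (as @ x # bs))"
  by (simp add: multilinear_def)

lemma multilinear_head: "multilinear f \<Longrightarrow> Vector_Spaces.linear s1 s2 (\<lambda>x. f (x # bs))"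
  using multilinear_slot[of f "[]"] by simp

lemma multilinear_add: "multilinear f \<Longrightarrow> f (as @ (x + y) # bs) = f (as @ x # bs) + f (as @ y # bs)"
  using linear_add[OF multilinear_slot] .

lemma linear_comp:
  "Vector_Spaces.linear s1 s1 T \<Longrightarrow> Vector_Spaces.linear s1 s2 f \<Longrightarrow>
    Vector_Spaces.linear s1 s2 (\<lambda>x. f (T x))"
  using Vector_Spaces.linear_compose[of s1 s1 T s2 f] by (simp add: comp_def)

lemma linear_comp':
  "Vector_Spaces.linear s1 s2 f \<Longrightarrow> Vector_Spaces.linear s2 s2 h \<Longrightarrow>
    Vector_Spaces.linear s1 s2 (\<lambda>x. h (f x))"
  using Vector_Spaces.linear_compose[of s1 s2 f s2 h] by (simp add: comp_def)

lemma linear_der: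
  assumes "\<And>zs. Vector_Spaces.linear s1 s2 (\<lambda>x. f x zs)"
  shows "Vector_Spaces.linear s1 s2 (\<lambda>x. der T (f x) ys)"
  unfolding der_eq_sum by (intro linear_compose_sum ballI assms)

lemma multilinear_der:
  assumes "multilinear f" "Vector_Spaces.linear s1 s1 T"
  shows "multilinear (der T f)"
proof -
  have "Vector_Spaces.linear s1 s2 (\<lambda>x. der T f (as @ x # bs))" for as bs
    using assms(1)
  proof (induction as arbitrary: f)
    case Nil
    have "Vector_Spaces.linear s1 s2 (\<lambda>x. der T (\<lambda>zs. f (x # zs)) bs)"
      by (intro linear_der multilinear_head Nil)
    then show ?case
      using linear_comp[OF assms(2) multilinear_head[OF Nil]] by (simp add: linear_compose_add)
  next
    case (Cons a as)
    show ?case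
      using multilinear_slot[OF Cons.prems, of "T a # as"] Cons.IH[OF multilinear_Cons[OF Cons.prems]]
      by (auto intro!: linear_compose_add)
  qed
  then show ?thesis by (simp add: multilinear_def)
qed

lemma linear_der_arg:
  assumes "multilinear f" "\<And>y. Vector_Spaces.linear s1 s1 (\<lambda>x. T x y)"
  shows "Vector_Spaces.linear s1 s2 (\<lambda>x. der (T x) f ys)"
  using assms(1)
proof (induction ys arbitrary: f)
  case (Cons y ys)
  then show ?case
    using linear_comp[OF assms(2) multilinear_head[OF Cons.prems]]
    by (simp add: linear_compose_add multilinear_Cons)
qed (simp add: linear_zero)

text \<open>Polarisation: expand the vanishing value at the repeated entry
  \<open>x + y\<close>.\<close>

lemma alternating_swap:
  assumes "multilinear f" "alternating f"
  shows "f (as @ x # y # bs) = - f (as @ y # x # bs)"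
proof -
  have "0 = f (as @ (x + y) # (x + y) # bs)"
    using assms(2) by (simp add: alternating_def)
  also have "\<dots> = f (as @ x # y # bs) + f (as @ y # x # bs)"
    using assms(2) multilinear_add[OF assms(1), of as x y "(x + y) # bs"]
      multilinear_add[OF assms(1), of "as @ [x]" x y bs]
      multilinear_add[OF assms(1), of "as @ [y]" x y bs]
    by (simp add: alternating_def)
  finally show ?thesis by (simp add: eq_neg_iff_add_eq_0)
qed

text \<open>Adjacent swaps carry the first \<open>x\<close> through \<open>bs\<close> until it meets
  the second, so the adjacent form used in \<open>alternating\<close> covers repetitions at any
  distance.\<close>

lemma alternating_apart:
  assumes "multilinear f" "alternating f"
  shows "f (as @ x # bs @ x # cs) = 0"
proof (induction bs arbitrary: as)
  case Nil
  then show ?case using assms(2) by (simp add: alternating_def)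
next
  case (Cons b bs)
  then show ?case
    using alternating_swap[OF assms, of as x b "bs @ x # cs"] Cons.IH[of "as @ [b]"] by simp
qed

text \<open>Applying \<open>T\<close> to one or the other of two equal neighbours gives two values
  that cancel by antisymmetry; applying it elsewhere leaves the repetition in place.\<close>

lemma alternating_der:
  assumes "multilinear f" "alternating f"
  shows "alternating (der T f)"
proof -
  have "der T f (as @ x # x # bs) = 0" for as x bs
    using assms
  proof (induction as arbitrary: f)
    case Nil
    have "f (x # x # zs) = 0" for zs
      using Nil(2)[unfolded alternating_def, rule_format, of "[]"] by simp
    then have "der T (\<lambda>zs. f (x # x # zs)) bs = 0"
      by (simp add: der_eq_sum)
    then show ?case
      using alternating_swap[OF Nil, of "[]" "T x" x] by simp
  next
    case (Cons a as)
    have "f (T a # as @ x # x # bs) = 0"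
      using Cons.prems(2)[unfolded alternating_def, rule_format, of "T a # as"] by simp
    then show ?case
      using Cons.IH[OF multilinear_Cons[OF Cons.prems(1)] alternating_Cons[OF Cons.prems(2)]]
      by simp
  qed
  then show ?thesis by (simp add: alternating_def)
qed

text \<open>The entry at position \<open>j\<close> reaches the front by \<open>j\<close> adjacent
  swaps, each costing a sign.\<close>

lemma alternating_move_front:
  assumes "multilinear f" "alternating f" "j < length ys"
  shows "f (a # nths ys (- {j})) = s2 ((-1) ^ j) (f (ys[j := a]))"
  using assms
proof (induction ys arbitrary: f j)
  case (Cons y ys)
  show ?case
  proof (cases j)
    case (Suc i)
    have "f (a # y # nths ys (- {i})) = - f (y # a # nths ys (- {i}))"
      using alternating_swap[OF Cons.prems(1,2), of "[]" a y] by simp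
    also have "\<dots> = - s2 ((-1) ^ i) (f (y # ys[i := a]))"
      using Cons.IH[OF multilinear_Cons[OF Cons.prems(1)] alternating_Cons[OF Cons.prems(2)]]
        Cons.prems(3) Suc by simp
    finally show ?thesis by (simp add: Suc nths_Cons_omit)
  qed (simp add: nths_Cons_omit)
qed simp

end

section \<open>The Chevalley--Eilenberg differential\<close>

text \<open>
  The recursion is Cartan's formula \<open>\<iota>\<^sub>x d = L\<^sub>x - d \<iota>\<^sub>x\<close>. The brackets stay in the slot of their
  second entry, so that \<open>d d = 0\<close> needs no alternation; that is needed only to move them to the front.
\<close>

fun ce_d :: "('g \<Rightarrow> 'g \<Rightarrow> 'g) \<Rightarrow> ('g \<Rightarrow> 'w \<Rightarrow> 'w) \<Rightarrow> ('g list \<Rightarrow> 'w::ab_group_add) \<Rightarrow> 'g list \<Rightarrow> 'w"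
  where
    "ce_d br act f [] = 0"
  | "ce_d br act f (x # ys) = act x (f ys) - der (br x) f ys - ce_d br act (\<lambda>zs. f (x # zs)) ys"

text \<open>Every term of the differential evaluates \<open>f\<close> at lists with exactly one
  entry fewer than \<open>ys\<close>.\<close>

lemma ce_d_eq_0:
  assumes "\<And>x. act x 0 = 0" "\<And>zs. Suc (length zs) = length ys \<Longrightarrow> f zs = 0"
  shows "ce_d br act f ys = 0"
  using assms(2)
proof (induction ys arbitrary: f)
  case (Cons y ys)
  have "der (br y) f ys = 0"
    by (simp add: der_eq_sum Cons.prems)
  moreover have "ce_d br act (\<lambda>zs. f (y # zs)) ys = 0"
    by (rule Cons.IH) (simp add: Cons.prems)
  ultimately show ?case by (simp add: Cons.prems assms(1))
qed simp

text \<open>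
  The carrier \<open>W\<close> is needed because \<open>hom_act\<close> below acts on all functions but satisfies
  \<open>act_br\<close> only on the linear ones.
\<close>

locale lie_module = list_cochains sg sw
  for sg :: "'k::field \<Rightarrow> 'g::ab_group_add \<Rightarrow> 'g" and sw :: "'k \<Rightarrow> 'w::ab_group_add \<Rightarrow> 'w" +
  fixes br :: "'g \<Rightarrow> 'g \<Rightarrow> 'g" and act :: "'g \<Rightarrow> 'w \<Rightarrow> 'w" and W :: "'w set"
  assumes br_linear: "Vector_Spaces.linear sg sg (br x)"
    and br_linear_arg: "Vector_Spaces.linear sg sg (\<lambda>x. br x y)"
    and br_self: "br x x = 0"
    and jacobi: "br x (br y z) = br (br x y) z + br y (br x z)"
    and subspace_W: "vs2.subspace W"
    and act_closed: "\<phi> \<in> W \<Longrightarrow> act x \<phi> \<in> W"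
    and act_linear: "Vector_Spaces.linear sw sw (act x)"
    and act_linear_arg: "\<phi> \<in> W \<Longrightarrow> Vector_Spaces.linear sg sw (\<lambda>x. act x \<phi>)"
    and act_br: "\<phi> \<in> W \<Longrightarrow> act (br x y) \<phi> = act x (act y \<phi>) - act y (act x \<phi>)"
begin

abbreviation d where "d \<equiv> ce_d br act"

lemma act_add: "act x (u + v) = act x u + act x v"
  and act_diff: "act x (u - v) = act x u - act x v"
  and act_zero: "act x 0 = 0"
  and act_scale: "act x (sw c u) = sw c (act x u)"
proof -
  interpret Vector_Spaces.linear sw sw "act x" by (rule act_linear)
  show "act x (u + v) = act x u + act x v" "act x (u - v) = act x u - act x v" "act x 0 = 0"
    "act x (sw c u) = sw c (act x u)"
    by (simp_all add: add diff zero scale)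
qed

lemma d_add: "d (\<lambda>zs. f zs + g zs) ys = d f ys + d g ys"
  by (induction ys arbitrary: f g) (simp_all add: der_add act_add)

lemma d_diff: "d (\<lambda>zs. f zs - g zs) ys = d f ys - d g ys"
  by (induction ys arbitrary: f g) (simp_all add: der_diff act_diff)

lemma d_scale: "d (\<lambda>zs. sw c (f zs)) ys = sw c (d f ys)"
  by (induction ys arbitrary: f)
    (simp_all add: der_hom[of "sw c"] act_scale vs2.scale_right_distrib vs2.scale_right_diff_distrib)

lemma linear_d:
  assumes "\<And>zs. Vector_Spaces.linear sg sw (\<lambda>x. f x zs)"
  shows "Vector_Spaces.linear sg sw (\<lambda>x. d (f x) ys)"
  using assms
  by (induction ys arbitrary: f)
    (auto intro!: linear_zero linear_compose_sub linear_der linear_comp'[OF _ act_linear])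

lemma der_closed: "(\<And>ys. f ys \<in> W) \<Longrightarrow> der T f ys \<in> W"
  unfolding der_eq_sum by (intro vs2.subspace_sum[OF subspace_W]) simp

lemma d_closed:
  assumes "\<And>ys. f ys \<in> W"
  shows "d f ys \<in> W"
  using assms
  by (induction ys arbitrary: f)
    (auto intro!: vs2.subspace_0 vs2.subspace_diff subspace_W act_closed der_closed)

text \<open>In the head slot all three terms of Cartan's formula are linear in \<open>x\<close>, the
  action term because the values of \<open>f\<close> lie in \<open>W\<close>. Later slots follow by
  induction, since fixing the head preserves multilinearity.\<close>

lemma multilinear_d:
  assumes "multilinear f" "\<And>ys. f ys \<in> W"
  shows "multilinear (d f)"
proof -
  have "Vector_Spaces.linear sg sw (\<lambda>x. d f (as @ x # bs))" for as bs
    using assms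
  proof (induction as arbitrary: f)
    case Nil
    then show ?case
      by (auto intro!: linear_compose_sub linear_d linear_der_arg act_linear_arg br_linear_arg
          multilinear_head)
  next
    case (Cons a as)
    show ?case
      using multilinear_slot[OF Cons.prems(1)] Cons.IH[OF multilinear_Cons[OF Cons.prems(1)] Cons.prems(2)]
        multilinear_slot[OF multilinear_der[OF Cons.prems(1) br_linear]]
      by (auto intro!: linear_compose_sub linear_comp'[OF _ act_linear])
  qed
  then show ?thesis by (simp add: multilinear_def)
qed

text \<open>For a repeated head \<open>x\<close>, expanding Cartan's formula twice cancels the
  action terms and the \<open>der\<close> terms. What remains is a value of \<open>f\<close> at
  \<open>br x x = 0\<close> and the differential of \<open>f (x # x # zs)\<close>, both
  zero.\<close>

lemma alternating_d:
  assumes "multilinear f" "alternating f"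
  shows "alternating (d f)"
proof -
  have "d f (as @ x # x # bs) = 0" for as x bs
    using assms
  proof (induction as arbitrary: f)
    case Nil
    have "f (x # x # zs) = 0" for zs
      using Nil(2)[unfolded alternating_def, rule_format, of "[]"] by simp
    moreover have "f (0 # bs) = 0"
      by (rule linear_0[OF multilinear_head[OF Nil(1)]])
    ultimately show ?case
      by (simp add: br_self ce_d_eq_0 act_zero)
  next
    case (Cons a as)
    have "f (as @ x # x # bs) = 0" "der (br a) f (as @ x # x # bs) = 0"
      using Cons.prems(2) alternating_der[OF Cons.prems] by (simp_all add: alternating_def)
    then show ?case
      using Cons.IH[OF multilinear_Cons[OF Cons.prems(1)] alternating_Cons[OF Cons.prems(2)]]
      by (simp add: act_zero)
  qed
  then show ?thesis by (simp add: alternating_def)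
qed

text \<open>Moving \<open>\<delta>\<close> and \<open>T\<close> past \<open>act x\<close> and
  \<open>der (br x)\<close> leaves correction terms. Together with the term where \<open>T\<close>
  hits the head inside \<open>f\<close>, they form Cartan's formula with head \<open>T x\<close>,
  which is the head term of \<open>der T (d f)\<close>.\<close>

lemma d_derivation:
  assumes f: "multilinear f" "\<And>ys. f ys \<in> W"
    and T: "\<And>x y. T (br x y) = br (T x) y + br x (T y)"
    and add: "\<And>u v. \<delta> (u + v) = \<delta> u + \<delta> v"
    and \<delta>: "\<And>x \<phi>. \<phi> \<in> W \<Longrightarrow> \<delta> (act x \<phi>) = act (T x) \<phi> + act x (\<delta> \<phi>)"
  shows "d (\<lambda>zs. \<delta> (f zs) - der T f zs) ys = \<delta> (d f ys) - der T (d f) ys"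
proof -
  interpret additive \<delta> by standard (rule add)
  show ?thesis
    using f
  proof (induction ys arbitrary: f)
    case (Cons x ys)
    have 1: "d (\<lambda>zs. \<delta> (f (x # zs)) - der T (\<lambda>zs. f (x # zs)) zs) ys
        = \<delta> (d (\<lambda>zs. f (x # zs)) ys) - der T (d (\<lambda>zs. f (x # zs))) ys"
      using Cons.prems by (intro Cons.IH multilinear_Cons)
    have 2: "d (\<lambda>zs. \<delta> (f (x # zs)) - (f (T x # zs) + der T (\<lambda>zs. f (x # zs)) zs)) ys
        = d (\<lambda>zs. \<delta> (f (x # zs)) - der T (\<lambda>zs. f (x # zs)) zs) ys - d (\<lambda>zs. f (T x # zs)) ys"
      by (simp add: d_diff d_add)
    \<comment> \<open>The derivation law turns the commutator of \<open>T\<close> and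
      \<open>br x\<close> into the inner derivation of \<open>T x\<close> up to sign; slotwise
      linearity of \<open>f\<close> then pulls the sign out of \<open>der\<close>.\<close>
    have "(\<lambda>y. br x (T y) - T (br x y)) = (\<lambda>y. - br (T x) y)"
      by (simp add: T)
    moreover have "f (zs[i := - b]) = - f (zs[i := b])" if "i < length zs" for zs i b
      using linear_neg[OF multilinear_slot[OF Cons.prems(1)]] that by (simp add: upd_conv_take_nth_drop)
    ultimately have 3: "der T (der (br x) f) ys - der (br x) (der T f) ys = - der (br (T x)) f ys"
      using der_commute[of f T "br x" ys, OF multilinear_add[OF Cons.prems(1)]]
      by (simp add: der_eq_sum[of _ f] sum_negf)
    show ?case
      using 3 \<delta>[OF Cons.prems(2)]
      by (simp add: 1 2 der_add der_diff act_diff diff add der_hom[of "act x"]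
          der_hom[of \<delta>] act_add algebra_simps)
  qed (simp add: zero)
qed

lemma d_d:
  assumes "multilinear f" "\<And>ys. f ys \<in> W"
  shows "d (d f) ys = 0"
  using assms
proof (induction ys arbitrary: f)
  case (Cons x ys)
  have "d (\<lambda>zs. act x (f zs) - der (br x) f zs) ys = act x (d f ys) - der (br x) (d f) ys"
  \<comment> \<open>The Jacobi identity says that \<open>br x\<close> is a derivation of the Lie
    algebra, and the module axiom supplies the matching law for \<open>act x\<close>.\<close>
  proof (rule d_derivation[where T = "br x" and \<delta> = "act x", OF Cons.prems jacobi act_add])
    show "act x (act y \<phi>) = act (br x y) \<phi> + act y (act x \<phi>)" if "\<phi> \<in> W" for y \<phi>
      by (simp add: act_br[OF that])
  qed
  then show ?case
    using Cons.IH[OF multilinear_Cons[OF Cons.prems(1)] Cons.prems(2)]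
      d_diff[of "\<lambda>zs. act x (f zs) - der (br x) f zs" "d (\<lambda>zs. f (x # zs))" ys]
    by simp
qed simp

lemma d_explicit:
  assumes "multilinear f" "alternating f"
  shows "d f xs =
      (\<Sum>i<length xs. sw ((-1) ^ i) (act (xs ! i) (f (nths xs (- {i})))))
    + (\<Sum>j<length xs. \<Sum>i<j. sw ((-1) ^ (i + j)) (f (br (xs ! i) (xs ! j) # nths xs (- {i, j}))))"
  using assms
proof (induction xs arbitrary: f)
  case (Cons x ys)
  \<comment> \<open>In brackets of two tail entries, the head \<open>x\<close> stands before the
    bracket. One swap puts the bracket first and absorbs the minus sign of Cartan's formula;
    \<open>i + j\<close> grows by two, so its sign is unchanged.\<close>
  have swap: "f (u # v # zs) = - f (v # u # zs)" for u v zs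
    using alternating_swap[OF Cons.prems, of "[]" u v zs] by simp
  have "der (br x) f ys
      = (\<Sum>j<length ys. sw ((-1) ^ j) (f (br x (ys ! j) # nths ys (- {j}))))"
    unfolding der_eq_sum
    by (intro sum.cong refl)
      (simp add: alternating_move_front[OF Cons.prems] flip: power_mult_distrib)
  then show ?case
    using Cons.IH[OF multilinear_Cons[OF Cons.prems(1)] alternating_Cons[OF Cons.prems(2)]]
    by (simp add: sum.lessThan_Suc_shift nths_Cons_omit sum_negf sum_subtractf sum.distrib
        swap[of "br _ _" x] del: sum.lessThan_Suc)
qed simp

end

section \<open>Pre-Lie cochains as cochains with values in \<open>Hom(g, V)\<close>\<close>

definition hom_scale :: "('k \<Rightarrow> 'v \<Rightarrow> 'v) \<Rightarrow> 'k \<Rightarrow> ('g \<Rightarrow> 'v) \<Rightarrow> 'g \<Rightarrow> 'v"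
  where "hom_scale s a \<phi> = (\<lambda>y. s a (\<phi> y))"

lemma vector_space_hom_scale:
  assumes "vector_space s"
  shows "vector_space (hom_scale s)"
proof -
  interpret vector_space s by fact
  show ?thesis
    by standard
      (auto simp: hom_scale_def fun_eq_iff scale_right_distrib scale_left_distrib)
qed

lemma vector_space_cochain_scale:
  assumes "vector_space s"
  shows "vector_space (cochain_scale s)"
proof -
  interpret vector_space s by fact
  show ?thesis
    by standard
      (auto simp: cochain_scale_def prod_eq_iff fun_eq_iff scale_right_distrib scale_left_distrib)
qed

lemma linear_hom_scale_iff:
  assumes "vector_space s"
  shows "Vector_Spaces.linear r (hom_scale s) F \<longleftrightarrow> vector_space r \<and> (\<forall>y. Vector_Spaces.linear r s (\<lambda>x. F x y))"
  using assms vector_space_hom_scale[OF assms]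
  by (auto simp: Vector_Spaces.linear_iff hom_scale_def fun_eq_iff)

definition curry_last :: "('g list \<Rightarrow> 'v) \<Rightarrow> 'g list \<Rightarrow> 'g \<Rightarrow> 'v"
  where "curry_last f ys y = f (ys @ [y])"

text \<open>Currying forgets only the value at the empty list, which is therefore compared
  separately.\<close>

lemma curry_last_eqD:
  assumes "curry_last f = curry_last g" "f [] = g []"
  shows "f = g"
proof
  fix xs
  show "f xs = g xs"
  proof (cases xs rule: rev_cases)
    case (snoc ys y)
    then show ?thesis using fun_cong[OF fun_cong[OF assms(1), of ys], of y]
      by (simp add: curry_last_def)
  qed (simp add: assms(2))
qed

section \<open>The sub-adjacent Lie algebra acting on Hom(g, V)\<close>

context pre_lie_rep
begin

definition hom_act :: "'g \<Rightarrow> ('g \<Rightarrow> 'v) \<Rightarrow> 'g \<Rightarrow> 'v"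
  where "hom_act x \<phi> = (\<lambda>y. \<rho> x (\<phi> y) + \<mu> y (\<phi> x) - \<phi> (mul x y))"

sublocale VP: list_cochains sg sv ..

lemma linear_simps:
  "mul (x + y) z = mul x z + mul y z" "mul x (y + z) = mul x y + mul x z"
  "mul (x - y) z = mul x z - mul y z" "mul x (y - z) = mul x y - mul x z"
  "mul (sg c x) z = sg c (mul x z)" "mul x (sg c z) = sg c (mul x z)"
  "\<rho> (x + y) u = \<rho> x u + \<rho> y u" "\<rho> x (u + v) = \<rho> x u + \<rho> x v"
  "\<rho> (x - y) u = \<rho> x u - \<rho> y u" "\<rho> x (u - v) = \<rho> x u - \<rho> x v"
  "\<rho> (sg c x) u = sv c (\<rho> x u)" "\<rho> x (sv c u) = sv c (\<rho> x u)"
  "\<mu> (x + y) u = \<mu> x u + \<mu> y u" "\<mu> x (u + v) = \<mu> x u + \<mu> x v"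
  "\<mu> (x - y) u = \<mu> x u - \<mu> y u" "\<mu> x (u - v) = \<mu> x u - \<mu> x v"
  "\<mu> (sg c x) u = sv c (\<mu> x u)" "\<mu> x (sv c u) = sv c (\<mu> x u)"
proof -
  interpret ml: Vector_Spaces.linear sg sg "\<lambda>x. mul x a" for a by (rule linear_mul_left)
  interpret mr: Vector_Spaces.linear sg sg "\<lambda>y. mul a y" for a by (rule linear_mul_right)
  interpret rl: Vector_Spaces.linear sg sv "\<lambda>x. \<rho> x w" for w by (rule linear_rho_arg)
  interpret rr: Vector_Spaces.linear sv sv "\<rho> a" for a by (rule linear_rho)
  interpret ul: Vector_Spaces.linear sg sv "\<lambda>x. \<mu> x w" for w by (rule linear_mu_arg)
  interpret ur: Vector_Spaces.linear sv sv "\<mu> a" for a by (rule linear_mu)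
  show
    "mul (x + y) z = mul x z + mul y z" "mul x (y + z) = mul x y + mul x z"
    "mul (x - y) z = mul x z - mul y z" "mul x (y - z) = mul x y - mul x z"
    "mul (sg c x) z = sg c (mul x z)" "mul x (sg c z) = sg c (mul x z)"
    "\<rho> (x + y) u = \<rho> x u + \<rho> y u" "\<rho> x (u + v) = \<rho> x u + \<rho> x v"
    "\<rho> (x - y) u = \<rho> x u - \<rho> y u" "\<rho> x (u - v) = \<rho> x u - \<rho> x v"
    "\<rho> (sg c x) u = sv c (\<rho> x u)" "\<rho> x (sv c u) = sv c (\<rho> x u)"
    "\<mu> (x + y) u = \<mu> x u + \<mu> y u" "\<mu> x (u + v) = \<mu> x u + \<mu> x v"
    "\<mu> (x - y) u = \<mu> x u - \<mu> y u" "\<mu> x (u - v) = \<mu> x u - \<mu> x v"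
    "\<mu> (sg c x) u = sv c (\<mu> x u)" "\<mu> x (sv c u) = sv c (\<mu> x u)"
    by (fact ml.add mr.add ml.diff mr.diff ml.scale mr.scale rl.add rr.add rl.diff rr.diff rl.scale
        rr.scale ul.add ur.add ul.diff ur.diff ul.scale ur.scale)+
qed

text \<open>The Jacobi defect is a signed sum of six associators. The pre-Lie identity is the
  symmetry of the associator in its first two arguments, so they cancel in pairs.\<close>

lemma commutator_jacobi:
  "commutator mul x (commutator mul y z)
    = commutator mul (commutator mul x y) z + commutator mul y (commutator mul x z)"
proof -
  define a where "a x y z = mul (mul x y) z - mul x (mul y z)" for x y z
  have a: "a x y z = a y x z" for x y z
    by (simp add: a_def pre_lie_identity)
  have "commutator mul x (commutator mul y z)
      - (commutator mul (commutator mul x y) z + commutator mul y (commutator mul x z))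
      = (a y x z - a x y z) + (a x z y - a z x y) + (a z y x - a y z x)"
    by (simp add: commutator_def linear_simps a_def algebra_simps)
  also have "\<dots> = 0"
    by (simp add: a[of y x z] a[of x z y] a[of z y x])
  finally show ?thesis by simp
qed

sublocale hom: lie_module sg "hom_scale sv" "commutator mul" hom_act
  "{\<phi>. Vector_Spaces.linear sg sv \<phi>}"
proof -
  interpret H: vector_space "hom_scale sv :: 'k \<Rightarrow> ('g \<Rightarrow> 'v) \<Rightarrow> 'g \<Rightarrow> 'v"
    by (rule vector_space_hom_scale) (rule V.vector_space_axioms)
  show "lie_module sg (hom_scale sv) (commutator mul) hom_act {\<phi>. Vector_Spaces.linear sg sv \<phi>}"
  proof (intro lie_module.intro lie_module_axioms.intro list_cochains.intro vector_space_pair.intro)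
    show "vector_space sg" "vector_space (hom_scale sv :: 'k \<Rightarrow> ('g \<Rightarrow> 'v) \<Rightarrow> 'g \<Rightarrow> 'v)"
      by (fact vector_space_axioms H.vector_space_axioms)+
    fix x y z and \<phi> :: "'g \<Rightarrow> 'v"
    show "commutator mul x x = 0" by (simp add: commutator_def)
    show "commutator mul x (commutator mul y z)
        = commutator mul (commutator mul x y) z + commutator mul y (commutator mul x z)"
      by (rule commutator_jacobi)
    show "Vector_Spaces.linear sg sg (commutator mul x)"
      by (simp add: Vector_Spaces.linear_iff vector_space_axioms commutator_def linear_simps
          scale_right_diff_distrib)
    show "Vector_Spaces.linear sg sg (\<lambda>x. commutator mul x y)"
      by (simp add: Vector_Spaces.linear_iff vector_space_axioms commutator_def linear_simps
          scale_right_diff_distrib)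
    show "H.subspace {\<phi>. Vector_Spaces.linear sg sv \<phi>}"
      by (auto simp: H.subspace_def hom_scale_def plus_fun_def zero_fun_def
          intro!: VP.linear_zero VP.linear_compose_add VP.linear_compose_scale_right)
    show "Vector_Spaces.linear (hom_scale sv) (hom_scale sv) (hom_act x)"
      unfolding Vector_Spaces.linear_iff
      by (auto simp: H.vector_space_axioms hom_act_def hom_scale_def fun_eq_iff linear_simps
          V.scale_right_distrib V.scale_right_diff_distrib)
    assume "\<phi> \<in> {\<phi>. Vector_Spaces.linear sg sv \<phi>}"
    then have "Vector_Spaces.linear sg sv \<phi>" by simp
    then interpret \<phi>: Vector_Spaces.linear sg sv \<phi> .
    show "hom_act x \<phi> \<in> {\<phi>. Vector_Spaces.linear sg sv \<phi>}"
      by (simp add: Vector_Spaces.linear_iff vector_space_axioms V.vector_space_axioms hom_act_def linear_simps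
          \<phi>.add \<phi>.scale V.scale_right_distrib V.scale_right_diff_distrib)
    show "Vector_Spaces.linear sg (hom_scale sv) (\<lambda>x. hom_act x \<phi>)"
      by (simp add: Vector_Spaces.linear_iff vector_space_axioms H.vector_space_axioms hom_act_def linear_simps
          hom_scale_def fun_eq_iff
          \<phi>.add \<phi>.scale V.scale_right_distrib V.scale_right_diff_distrib)
    show "hom_act (commutator mul x y) \<phi> = hom_act x (hom_act y \<phi>) - hom_act y (hom_act x \<phi>)"
    proof
      fix z
      \<comment> \<open>The compatibility axiom is solved for the composite of two
        \<open>\<mu>\<close>, and below the pre-Lie identity under \<open>\<phi>\<close> for one
        triple product, so that both serve as rewrite rules.\<close>
      have \<mu>: "\<mu> z (\<mu> a u) = \<mu> (mul a z) u + \<mu> z (\<rho> a u) - \<rho> a (\<mu> z u)" for a u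
        using mu_mul[of z a u] by (simp add: algebra_simps)
      have "\<phi> (mul (mul x y) z) - \<phi> (mul x (mul y z))
          = \<phi> (mul (mul y x) z) - \<phi> (mul y (mul x z))"
        by (metis \<phi>.diff pre_lie_identity)
      then have \<phi>: "\<phi> (mul (mul x y) z)
          = \<phi> (mul x (mul y z)) + \<phi> (mul (mul y x) z) - \<phi> (mul y (mul x z))"
        by (simp add: algebra_simps)
      show "hom_act (commutator mul x y) \<phi> z
          = (hom_act x (hom_act y \<phi>) - hom_act y (hom_act x \<phi>)) z"
        \<comment> \<open>\<open>rho_commutator\<close> has to fire before \<open>commutator\<close>
          is unfolded, hence two rounds of simplification.\<close>
        by (simp add: hom_act_def rho_commutator)
          (simp add: commutator_def linear_simps \<phi>.diff \<mu> \<phi>)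
    qed
  qed
qed

text \<open>Linearity in the last slot becomes linearity of the values, and the other slots give
  multilinearity. Lists of other lengths do no harm because \<open>f\<close> is 0 there.\<close>

lemma wedge_hom_iff:
  "f \<in> wedge_hom sg sv p \<longleftrightarrow> (\<forall>xs. length xs \<noteq> Suc p \<longrightarrow> f xs = 0) \<and>
    hom.multilinear (curry_last f) \<and> alternating (curry_last f) \<and>
    (\<forall>ys. Vector_Spaces.linear sg sv (curry_last f ys))"
proof (cases "\<forall>xs. length xs \<noteq> Suc p \<longrightarrow> f xs = 0")
  case True
  have "(\<forall>xs i. length xs = Suc p \<longrightarrow> i < Suc p \<longrightarrow> Vector_Spaces.linear sg sv (\<lambda>x. f (xs[i := x])))
      \<longleftrightarrow> hom.multilinear (curry_last f) \<and> (\<forall>ys. Vector_Spaces.linear sg sv (curry_last f ys))"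
    (is "?A \<longleftrightarrow> ?B")
  proof
    assume A: ?A
    have "Vector_Spaces.linear sg sv (\<lambda>x. f (as @ x # bs))" for as bs
    proof (cases "length (as @ 0 # bs) = Suc p")
      case True
      then show ?thesis using A[rule_format, of "as @ 0 # bs" "length as"] by simp
    next
      case False
      then show ?thesis using True by (simp add: VP.linear_zero)
    qed
    moreover have "curry_last f ys = (\<lambda>y. f (ys @ [y]))" for ys
      by (simp add: curry_last_def fun_eq_iff)
    ultimately show ?B
      by (simp add: hom.multilinear_def curry_last_def linear_hom_scale_iff vector_space_axioms
          V.vector_space_axioms)
  next
    assume B: ?B
    show ?A
    proof (intro allI impI)
      fix xs :: "'g list" and i
      assume xs: "length xs = Suc p" "i < Suc p"
      then obtain ys y where ys: "xs = ys @ [y]" by (cases xs rule: rev_cases) auto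
      show "Vector_Spaces.linear sg sv (\<lambda>x. f (xs[i := x]))"
      proof (cases "i = p")
        case True
        moreover have "(\<lambda>x. f (ys @ [x])) = curry_last f ys"
          by (simp add: curry_last_def fun_eq_iff)
        ultimately show ?thesis using B xs ys by (simp add: list_update_append)
      next
        case False
        then show ?thesis
          using B xs ys by (simp add: list_update_append upd_conv_take_nth_drop hom.multilinear_def
              curry_last_def linear_hom_scale_iff V.vector_space_axioms)
      qed
    qed
  qed
  \<comment> \<open>Passing from adjacent to distant repetitions rests on antisymmetry, hence the
    condition of multilinearity.\<close>
  moreover have "(\<forall>xs i j. length xs = Suc p \<longrightarrow> i < j \<longrightarrow> j < p \<longrightarrow> xs ! i = xs ! j \<longrightarrow> f xs = 0)
      \<longleftrightarrow> alternating (curry_last f)" (is "?A \<longleftrightarrow> ?C")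
    if "hom.multilinear (curry_last f)"
  proof
    assume A: ?A
    have "f (as @ x # x # bs @ [y]) = 0" for as x bs y
    proof (cases "length (as @ x # x # bs @ [y]) = Suc p")
      case True
      then show ?thesis
        using A[rule_format, of "as @ x # x # bs @ [y]" "length as" "Suc (length as)"]
        by (simp add: nth_append)
    qed (use True in blast)
    then show ?C by (simp add: alternating_def curry_last_def fun_eq_iff)
  next
    assume C: ?C
    show ?A
    proof (intro allI impI)
      fix xs :: "'g list" and i j
      assume xs: "length xs = Suc p" "i < j" "j < p" "xs ! i = xs ! j"
      then obtain ys y where ys: "xs = ys @ [y]" by (cases xs rule: rev_cases) auto
      define as bs cs where "as = take i ys" and "bs = drop (Suc i) (take j ys)"
        and "cs = drop (Suc j) ys"
      have "ys = take j ys @ ys ! j # cs"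
        unfolding cs_def using xs ys by (intro id_take_nth_drop) simp
      also have "take j ys = as @ ys ! i # bs"
        using id_take_nth_drop[of i "take j ys"] xs ys by (simp add: as_def bs_def min_def)
      finally have "ys = as @ ys ! i # bs @ ys ! i # cs"
        using xs ys by (simp add: nth_append)
      then show "f xs = 0"
        using hom.alternating_apart[OF that C, of as "ys ! i" bs cs] ys
        by (metis curry_last_def zero_fun_apply)
    qed
  qed
  ultimately show ?thesis using True by (auto simp: wedge_hom_def)
qed (auto simp: wedge_hom_def)

lemma sum_apply: "(\<Sum>i\<in>I. F i) y = (\<Sum>i\<in>I. F i y)" for F :: "'i \<Rightarrow> 'g \<Rightarrow> 'v"
  by (induction I rule: infinite_finite_induct) auto

text \<open>Evaluating \<open>d_explicit\<close> at the last argument \<open>y\<close>, the three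
  terms of \<open>hom_act\<close> yield the first three sums of the coboundary and the brackets
  yield the fourth.\<close>

lemma curry_last_pre_lie_d:
  assumes "f \<in> wedge_hom sg sv p"
  shows "curry_last (pre_lie_d sv mul \<rho> \<mu> (Suc p) f) = hom.d (curry_last f)"
proof (intro ext)
  fix ys :: "'g list" and y
  note f = assms[unfolded wedge_hom_iff]
  let ?n = "length ys"
  show "curry_last (pre_lie_d sv mul \<rho> \<mu> (Suc p) f) ys y = hom.d (curry_last f) ys y"
  proof (cases "?n = Suc p")
    case True
    \<comment> \<open>Position \<open>length ys\<close> holds the last argument \<open>y\<close>, so
      omitting \<open>i\<close> and that position amounts to omitting \<open>i\<close> from
      \<open>ys\<close>.\<close>
    have [simp]: "nths (ys @ [y]) (- {i}) = nths ys (- {i}) @ [y]"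
      "nths (ys @ [y]) (- {i, ?n}) = nths ys (- {i})"
      "j < ?n \<Longrightarrow> nths (ys @ [y]) (- {i, j}) = nths ys (- {i, j}) @ [y]" if "i < ?n" for i j
    proof -
      have "nths ys (- {i, ?n}) = nths ys (- {i})"
        unfolding nths_def by (intro arg_cong[where f = "map fst"] filter_cong refl)
          (auto simp: set_zip)
      then show "nths (ys @ [y]) (- {i}) = nths ys (- {i}) @ [y]"
        "nths (ys @ [y]) (- {i, ?n}) = nths ys (- {i})"
        "j < ?n \<Longrightarrow> nths (ys @ [y]) (- {i, j}) = nths ys (- {i, j}) @ [y]"
        using that by (auto simp: nths_append)
    qed
    show ?thesis
      using f
      by (simp add: hom.d_explicit sum_apply hom_scale_def hom_act_def curry_last_def pre_lie_d_def
          nth_append V.scale_right_distrib V.scale_right_diff_distrib sum.distrib sum_subtractf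
          flip: True cong: sum.cong_simp)
  next
    case False
    then have "hom.d (curry_last f) ys = 0"
      using f by (intro ce_d_eq_0) (auto simp: hom.act_zero curry_last_def fun_eq_iff)
    then show ?thesis using False by (simp add: curry_last_def pre_lie_d_def)
  qed
qed

lemma pre_lie_d_wedge_hom:
  assumes "f \<in> wedge_hom sg sv p"
  shows "pre_lie_d sv mul \<rho> \<mu> (Suc p) f \<in> wedge_hom sg sv (Suc p)"
proof -
  note f = assms[unfolded wedge_hom_iff]
  have "hom.d (curry_last f) ys \<in> {\<phi>. Vector_Spaces.linear sg sv \<phi>}" for ys
    using f by (intro hom.d_closed) auto
  then show ?thesis
    unfolding wedge_hom_iff curry_last_pre_lie_d[OF assms]
    using f by (auto simp: pre_lie_d_def intro!: hom.multilinear_d hom.alternating_d)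
qed

lemma pre_lie_d_d:
  assumes "f \<in> wedge_hom sg sv p"
  shows "pre_lie_d sv mul \<rho> \<mu> (Suc (Suc p)) (pre_lie_d sv mul \<rho> \<mu> (Suc p) f) = 0"
proof (rule curry_last_eqD)
  note f = assms[unfolded wedge_hom_iff]
  have "hom.d (hom.d (curry_last f)) ys = 0" for ys
    using f by (intro hom.d_d) auto
  then show "curry_last (pre_lie_d sv mul \<rho> \<mu> (Suc (Suc p)) (pre_lie_d sv mul \<rho> \<mu> (Suc p) f))
      = curry_last 0"
    by (simp add: curry_last_pre_lie_d pre_lie_d_wedge_hom assms fun_eq_iff curry_last_def[of 0])
qed (simp add: pre_lie_d_def)

lemma pre_lie_d_0: "pre_lie_d sv mul \<rho> \<mu> n 0 = 0"
proof -
  have "\<rho> x 0 = 0" "\<mu> x 0 = 0" for x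
    using linear_simps(10,16)[of x 0 0] by simp_all
  then show ?thesis by (auto simp: pre_lie_d_def fun_eq_iff)
qed

lemma pre_lie_d_add:
  "pre_lie_d sv mul \<rho> \<mu> n (f + g) = pre_lie_d sv mul \<rho> \<mu> n f + pre_lie_d sv mul \<rho> \<mu> n g"
  by (auto simp: pre_lie_d_def fun_eq_iff linear_simps V.scale_right_distrib sum.distrib)

lemma pre_lie_d_scale:
  "pre_lie_d sv mul \<rho> \<mu> n (\<lambda>xs. sv c (f xs)) = (\<lambda>xs. sv c (pre_lie_d sv mul \<rho> \<mu> n f xs))"
  by (auto simp: pre_lie_d_def fun_eq_iff linear_simps V.scale_right_distrib
      V.scale_right_diff_distrib V.scale_sum_right mult.commute)

lemma wedge_hom_closed:
  "f \<in> wedge_hom sg sv p \<Longrightarrow> g \<in> wedge_hom sg sv p \<Longrightarrow> f + g \<in> wedge_hom sg sv p"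
  "f \<in> wedge_hom sg sv p \<Longrightarrow> (\<lambda>xs. sv c (f xs)) \<in> wedge_hom sg sv p"
  "0 \<in> wedge_hom sg sv p"
  by (auto simp: wedge_hom_def VP.linear_zero VP.linear_compose_add VP.linear_compose_scale_right)

end

section \<open>The derivation induced by \<open>D\<close> and \<open>K\<close>\<close>

context regular_pre_LieDer_rep
begin

definition hom_der :: "('g \<Rightarrow> 'v) \<Rightarrow> 'g \<Rightarrow> 'v"
  where "hom_der \<phi> = (\<lambda>y. K (\<phi> y) - \<phi> (D y))"

text \<open>This is the negative of \<open>Omega\<close> without its scalar factor:
  \<open>hom_der\<close> accounts for \<open>K\<close> and the last slot, \<open>der\<close> for the
  other slots.\<close>

definition lie_D :: "('g list \<Rightarrow> 'g \<Rightarrow> 'v) \<Rightarrow> 'g list \<Rightarrow> 'g \<Rightarrow> 'v"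
  where "lie_D F = (\<lambda>ys. hom_der (F ys) - der D F ys)"

lemma K_simps: "K (u + v) = K u + K v" "K (u - v) = K u - K v" "K (sv c u) = sv c (K u)" "K 0 = 0"
proof -
  interpret K: Vector_Spaces.linear sv sv K by (rule linear_K)
  show "K (u + v) = K u + K v" "K (u - v) = K u - K v" "K (sv c u) = sv c (K u)" "K 0 = 0"
    by (fact K.add K.diff K.scale K.zero)+
qed

lemma hom_der_linear: "Vector_Spaces.linear (hom_scale sv) (hom_scale sv) hom_der"
  unfolding Vector_Spaces.linear_iff
  by (auto simp: hom.vs2.vector_space_axioms hom_der_def hom_scale_def fun_eq_iff K_simps
      V.scale_right_diff_distrib)

text \<open>Leibniz rule for the pair of \<open>D\<close> and \<open>hom_der\<close>: the three
  terms of \<open>hom_act\<close> are handled by \<open>K_rho\<close>, \<open>K_mu\<close> and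
  \<open>D_mul\<close> respectively.\<close>

lemma hom_der_act:
  assumes "Vector_Spaces.linear sg sv \<phi>"
  shows "hom_der (hom_act x \<phi>) = hom_act (D x) \<phi> + hom_act x (hom_der \<phi>)"
proof
  interpret \<phi>: Vector_Spaces.linear sg sv \<phi> by fact
  show "hom_der (hom_act x \<phi>) y = (hom_act (D x) \<phi> + hom_act x (hom_der \<phi>)) y" for y
    by (simp add: hom_der_def hom_act_def K_simps K_rho K_mu linear_simps D_mul \<phi>.add
        algebra_simps)
qed

lemma D_commutator:
  "D (commutator mul x y) = commutator mul (D x) y + commutator mul x (D y)"
proof -
  interpret D: Vector_Spaces.linear sg sg D by (rule linear_D)
  show ?thesis by (simp add: commutator_def D.diff D_mul)
qed

lemma d_lie_D:
  assumes "hom.multilinear F" "\<And>ys. Vector_Spaces.linear sg sv (F ys)"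
  shows "hom.d (lie_D F) = lie_D (hom.d F)"
proof
  fix ys
  show "hom.d (lie_D F) ys = lie_D (hom.d F) ys"
    unfolding lie_D_def
    using assms by (intro hom.d_derivation hom_der_act D_commutator) (simp_all add: hom_der_def fun_eq_iff K_simps)
qed

lemma curry_last_Omega:
  assumes "f \<in> wedge_hom sg sv p"
  shows "curry_last (Omega sv D K (Suc p) f) =
    (\<lambda>ys. hom_scale sv (- ((-1) powi (int p - 1))) (lie_D (curry_last f) ys))"
proof (intro ext)
  fix ys :: "'g list" and y
  note f = assms[unfolded wedge_hom_iff]
  have der: "der D (curry_last f) ys y = der D (\<lambda>zs. f (zs @ [y])) ys"
    by (simp add: der_eq_sum sum_apply curry_last_def)
  show "curry_last (Omega sv D K (Suc p) f) ys y =
    hom_scale sv (- ((-1) powi (int p - 1))) (lie_D (curry_last f) ys) y"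
  proof (cases "length ys = p")
    case True
    \<comment> \<open>Splitting off the last slot isolates \<open>f (ys @ [D y])\<close>, the part
      of \<open>hom_der\<close> that involves \<open>D\<close>.\<close>
    have "(\<Sum>i<Suc p. f ((ys @ [y])[i := D ((ys @ [y]) ! i)]))
        = der D (\<lambda>zs. f (zs @ [y])) ys + f (ys @ [D y])"
      using True by (simp add: der_eq_sum[of _ f, symmetric] der_snoc[symmetric])
        (simp add: der_eq_sum)
    moreover have "int (Suc p) - 2 = int p - 1" by simp
    ultimately show ?thesis
      using True by (simp add: curry_last_def[of "Omega _ _ _ _ _"] Omega_def hom_scale_def
          lie_D_def hom_der_def der
          curry_last_def[of f] V.scale_right_diff_distrib V.scale_right_distrib
          del: sum.lessThan_Suc)
  next
    case False
    then show ?thesis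
      using f by (simp add: der lie_D_def hom_scale_def hom_der_def curry_last_def Omega_def
          der_eq_sum sum_apply K_simps)
  qed
qed

lemma Omega_wedge_hom:
  assumes "f \<in> wedge_hom sg sv p"
  shows "Omega sv D K (Suc p) f \<in> wedge_hom sg sv p"
proof -
  note f = assms[unfolded wedge_hom_iff]
  let ?F = "curry_last f"
  define c :: 'k where "c = - ((-1) powi (int p - 1))"
  have "hom.multilinear (\<lambda>ys. hom_scale sv c (lie_D ?F ys))"
    using f hom.multilinear_der[of ?F D] linear_D
      hom.linear_comp'[OF _ hom_der_linear]
    unfolding hom.multilinear_def lie_D_def
    by (intro allI hom.linear_compose_scale_right hom.linear_compose_sub) blast+
  moreover have "alternating (\<lambda>ys. hom_scale sv c (lie_D ?F ys))"
    using f hom.alternating_der[of ?F D]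
    by (simp add: alternating_def lie_D_def hom_scale_def hom_der_def fun_eq_iff K_simps)
  moreover have "Vector_Spaces.linear sg sv (hom_scale sv c (lie_D ?F ys))" for ys
  proof -
    have "Vector_Spaces.linear sg sv (der D ?F ys)"
      using hom.der_closed[of ?F D ys] f by simp
    moreover have "Vector_Spaces.linear sg sv (\<lambda>y. K (?F ys y))"
      using VP.linear_comp' f linear_K by blast
    moreover have "Vector_Spaces.linear sg sv (\<lambda>y. ?F ys (D y))"
      using VP.linear_comp f linear_D by blast
    ultimately show ?thesis
      by (auto simp: lie_D_def hom_der_def hom_scale_def fun_diff_def
          intro!: VP.linear_compose_scale_right VP.linear_compose_sub)
  qed
  ultimately show ?thesis
    unfolding wedge_hom_iff curry_last_Omega[OF assms] c_def by (simp add: Omega_def)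
qed

lemma d_Omega:
  assumes "f \<in> wedge_hom sg sv p"
  shows "pre_lie_d sv mul \<rho> \<mu> (Suc p) (Omega sv D K (Suc p) f)
    + Omega sv D K (Suc (Suc p)) (pre_lie_d sv mul \<rho> \<mu> (Suc p) f) = 0" (is "?A + ?B = 0")
proof (rule curry_last_eqD)
  note f = assms[unfolded wedge_hom_iff]
  define c :: 'k where "c = - ((-1) powi (int p - 1))"
  \<comment> \<open>One more argument flips the sign of the factor in
    \<open>curry_last_Omega\<close>: it is \<open>c\<close> for \<open>f\<close> and
    \<open>- c\<close> for its coboundary, which makes the two summands cancel.\<close>
  have "(-1 :: 'k) powi (int (Suc p) - 1) = (-1) powi ((int p - 1) + 1)" by simp
  also have "\<dots> = c"
    unfolding c_def by (subst power_int_add) simp_all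
  finally have c: "(-1 :: 'k) powi (int (Suc p) - 1) = c" .
  have "curry_last ?A ys = hom_scale sv c (lie_D (hom.d (curry_last f)) ys)" for ys
    using f by (simp add: curry_last_pre_lie_d Omega_wedge_hom assms curry_last_Omega hom.d_scale
        d_lie_D flip: c_def)
  moreover have "curry_last ?B ys = hom_scale sv (- c) (lie_D (hom.d (curry_last f)) ys)" for ys
    by (simp add: curry_last_pre_lie_d pre_lie_d_wedge_hom assms curry_last_Omega c
        del: of_nat_Suc)
  moreover have "curry_last (?A + ?B) ys = curry_last ?A ys + curry_last ?B ys" for ys
    by (simp add: curry_last_def fun_eq_iff)
  ultimately show "curry_last (?A + ?B) = curry_last 0"
    by (simp add: fun_eq_iff hom_scale_def curry_last_def[of 0])
qed (simp add: pre_lie_d_def Omega_def)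

lemma Omega_0: "Omega sv D K n 0 = 0"
  by (auto simp: Omega_def fun_eq_iff K_simps)

lemma Omega_add: "Omega sv D K n (f + g) = Omega sv D K n f + Omega sv D K n g"
  by (auto simp: Omega_def fun_eq_iff K_simps sum.distrib V.scale_right_distrib
      V.scale_right_diff_distrib)

lemma Omega_scale: "Omega sv D K n (\<lambda>xs. sv c (f xs)) = (\<lambda>xs. sv c (Omega sv D K n f xs))"
  by (auto simp: Omega_def fun_eq_iff K_simps V.scale_sum_right V.scale_right_diff_distrib mult.commute)

section \<open>Assembling the cochain complex\<close>

lemma mem_cochains_Suc:
  "(f, \<theta>) \<in> cochains sg sv (Suc p) \<longleftrightarrow>
    f \<in> wedge_hom sg sv p \<and> (if p = 0 then \<theta> = 0 else \<theta> \<in> wedge_hom sg sv (p - 1))"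
  by (cases p) auto

abbreviation \<D> where "\<D> \<equiv> pre_LieDer_d sv mul D K \<rho> \<mu>"

lemma pre_LieDer_d_mem:
  assumes "c \<in> cochains sg sv n"
  shows "\<D> n c \<in> cochains sg sv (Suc n)"
proof (cases n)
  case 0
  then show ?thesis using wedge_hom_closed(3) by (simp add: zero_prod_def)
next
  case (Suc p)
  obtain f \<theta> where c: "c = (f, \<theta>)" by (cases c)
  have f: "f \<in> wedge_hom sg sv p"
    using assms by (simp add: Suc c mem_cochains_Suc)
  have "pre_lie_d sv mul \<rho> \<mu> p \<theta> \<in> wedge_hom sg sv p"
  proof (cases p)
    case 0
    \<comment> \<open>In degree one the second component is 0 by convention, so its coboundary is
      the zero map.\<close>
    then show ?thesis
      using assms Suc by (simp add: c pre_lie_d_0 wedge_hom_closed(3))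
  next
    case (Suc m)
    then show ?thesis
      using assms \<open>n = Suc p\<close> by (auto simp: c intro: pre_lie_d_wedge_hom)
  qed
  then show ?thesis
    using f unfolding Suc c pre_LieDer_d.simps mem_cochains_Suc
    by (simp add: pre_lie_d_wedge_hom Omega_wedge_hom wedge_hom_closed(1))
qed

lemma pre_LieDer_d_d:
  assumes "c \<in> cochains sg sv n"
  shows "\<D> (Suc n) (\<D> n c) = 0"
proof (cases n)
  case 0
  then show ?thesis by (simp add: zero_prod_def pre_lie_d_0 Omega_0)
next
  case (Suc p)
  obtain f \<theta> where c: "c = (f, \<theta>)" by (cases c)
  have f: "f \<in> wedge_hom sg sv p"
    using assms by (simp add: Suc c mem_cochains_Suc)
  have "pre_lie_d sv mul \<rho> \<mu> (Suc p) (pre_lie_d sv mul \<rho> \<mu> p \<theta>) = 0"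
    using assms Suc by (cases p) (auto simp: c pre_lie_d_0 intro: pre_lie_d_d)
  \<comment> \<open>The first component is the double coboundary of \<open>f\<close>; the second is
    that of \<open>\<theta>\<close> plus the sum shown to vanish in \<open>d_Omega\<close>.\<close>
  then show ?thesis
    using d_Omega[OF f] pre_lie_d_d[OF f]
    by (simp add: Suc c zero_prod_def pre_lie_d_add add.assoc)
qed

lemma pre_LieDer_d_add: "\<D> n (b + c) = \<D> n b + \<D> n c"
  by (cases n; cases b; cases c) (simp_all add: pre_lie_d_add Omega_add)

lemma pre_LieDer_d_scale: "\<D> n (cochain_scale sv a c) = cochain_scale sv a (\<D> n c)"
proof (cases n)
  case 0
  then show ?thesis by (simp add: cochain_scale_def zero_prod_def zero_fun_def)
next
  case (Suc p)
  then show ?thesis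
    by (cases c) (simp add: cochain_scale_def pre_lie_d_scale Omega_scale V.scale_right_distrib plus_fun_def)
qed

lemma subspace_cochains: "module.subspace (cochain_scale sv) (cochains sg sv n)"
proof -
  interpret C: vector_space "cochain_scale sv :: 'k \<Rightarrow> ('g list \<Rightarrow> 'v) \<times> ('g list \<Rightarrow> 'v) \<Rightarrow> _"
    by (rule vector_space_cochain_scale) (rule V.vector_space_axioms)
  show ?thesis
  proof (cases n)
    case (Suc p)
    then show ?thesis
      by (auto simp: C.subspace_def mem_cochains_Suc zero_prod_def cochain_scale_def
          wedge_hom_closed zero_fun_def[symmetric])
  qed simp
qed

end

theorem theorem5p3:
  fixes sg :: "'k::{alg_closed_field, field_char_0} \<Rightarrow> 'g::ab_group_add \<Rightarrow> 'g"
    and mul :: "'g \<Rightarrow> 'g \<Rightarrow> 'g"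
    and D :: "'g \<Rightarrow> 'g"
    and sv :: "'k \<Rightarrow> 'v::ab_group_add \<Rightarrow> 'v"
    and K :: "'v \<Rightarrow> 'v"
    and \<rho> \<mu> :: "'g \<Rightarrow> 'v \<Rightarrow> 'v"
  assumes "regular_pre_LieDer_rep sg mul D sv K \<rho> \<mu>"
  shows "cochain_complex (cochain_scale sv) (cochains sg sv)
    (pre_LieDer_d sv mul D K \<rho> \<mu>)"
proof -
  interpret regular_pre_LieDer_rep sg mul D sv K \<rho> \<mu> by fact
  show ?thesis
    unfolding cochain_complex_def
    using vector_space_cochain_scale[OF V.vector_space_axioms] subspace_cochains pre_LieDer_d_mem
      pre_LieDer_d_add pre_LieDer_d_scale pre_LieDer_d_d
    by blast
qed

end
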